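(* For every finite set of formulas $\Gamma$ and every formula $\gamma$: if $\Gamma\Vdash\gamma$ (validity in the base-extension semantics), then $\Gamma\vdash\gamma$ (classical consequence).
   Context: Let $\mathbb{C}$ be a denumerable set of contents and $\mathbb{L}=\{c^+,c^-: c\in\mathbb{C}\}$ the literals. Formulas: literals, $\bot$, $\top$, and $\phi\land\psi$, $\phi\lor\psi$, $\phi\to\psi$. Duality: $(c^+)^\bot=c^-$, $(c^-)^\bot=c^+$, $\bot^\bot=\top$, $\top^\bot=\bot$, $(\phi\land\psi)^\bot=\phi^\bot\lor\psi^\bot$, $(\phi\lor\psi)^\bot=\phi^\bot\land\psi^\bot$, $(\phi\to\psi)^\bot=\phi\land\psi^\bot$. Classical consequence: a valuation is $v:\mathbb{L}\to\{0,1\}$ with $v(c^-)=1-v(c^+)$, extended by $v(\bot)=0$, $v(\top)=1$, $\min$ for $\land$, $\max$ for $\lor$, $v(\phi\to\psi)=\max\{1-v(\phi),v(\psi)\}$; $\Gamma\vdash\phi$ iff every valuation giving value $1$ to all members of $\Gamma$ gives $\phi$ value $1$. Bases: an atomic rule is $(L_1\Rightarrow l_1),\ldots,(L_n\Rightarrow l_n)\Rightarrow l$ ($n\ge0$, $l,l_i\in\mathbb{L}$, $L_i\subseteq\mathbb{L}$ finite); a base is a set of atomic rules. Derivability $L\vdash_{\mathcal{B}} l$ ($L\subseteq\mathbb{L}$ finite, $l\in\mathbb{L}\cup\{\bot\}$) is the smallest relation closed under: (REF) $l\in L$ gives $L\vdash_{\mathcal{B}} l$; (APP$_1$) $(\Rightarrow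 l)\in\mathcal{B}$ gives $L\vdash_{\mathcal{B}} l$; (APP$_2$) if $(L_1\Rightarrow l_1),\ldots,(L_n\Rightarrow l_n)\Rightarrow l\in\mathcal{B}$ and $L\cup L_i\vdash_{\mathcal{B}} l_i$ for all $i$ then $L\vdash_{\mathcal{B}} l$; (ABS) $L\vdash_{\mathcal{B}} m$ and $L\vdash_{\mathcal{B}} m^\bot$ give $L\vdash_{\mathcal{B}}\bot$; (DM) $L\cup\{m\}\vdash_{\mathcal{B}}\bot$ gives $L\vdash_{\mathcal{B}} m^\bot$. Support (defined by induction on logical weight): $\Vdash_{\mathcal{B}} l$ iff $\emptyset\vdash_{\mathcal{B}} l$ for $l\in\mathbb{L}$; $\Vdash_{\mathcal{B}}\bot$ iff $\emptyset\vdash_{\mathcal{B}} l$ for all $l\in\mathbb{L}$; $\Vdash_{\mathcal{B}}\top$ always; $\Vdash_{\mathcal{B}}\phi\to\psi$ iff $\{\phi\}\Vdash_{\mathcal{B}}\psi$; $\Vdash_{\mathcal{B}}\phi\land\psi$ iff $\Vdash_{\mathcal{B}}\phi$ and $\Vdash_{\mathcal{B}}\psi$; $\Vdash_{\mathcal{B}}\phi\lor\psi$ iff for all bases $\mathcal{C}\supseteq\mathcal{B}$ and all $l\in\mathbb{L}$, if $\{\phi\}\Vdash_{\mathcal{C}} l$ and $\{\psi\}\Vdash_{\mathcal{C}} l$ then $\Vdash_{\mathcal{C}} l$; for a nonempty finite set $\Delta$, $\Delta\Vdash_{\mathcal{B}}\phi$ iff for all bases $\mathcal{C}\supseteq\mathcal{B}$,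 if $\Vdash_{\mathcal{C}}\delta$ for every $\delta\in\Delta$ then $\Vdash_{\mathcal{C}}\phi$; $\emptyset\Vdash_{\mathcal{B}}\phi$ means $\Vdash_{\mathcal{B}}\phi$. Finally $\Gamma\Vdash\phi$ iff $\Gamma\Vdash_{\mathcal{B}}\phi$ for every base $\mathcal{B}$. *)

theory Defs
  imports Main "HOL-Library.FSet" "HOL-Library.Countable_Set"
begin

datatype 'c literal = Pos 'c | Neg 'c

fun lit_dual :: "'c literal \<Rightarrow> 'c literal" where
  "lit_dual (Pos c) = Neg c"
| "lit_dual (Neg c) = Pos c"

datatype 'c form =
    Lit "'c literal"
  | Bot
  | Top
  | And "'c form" "'c form"
  | Or "'c form" "'c form"
  | Imp "'c form" "'c form"

text \<open>Classical consequence. A valuation takes values in the two-element set of integers 0 and 1.\<close>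

definition valuation :: "('c literal \<Rightarrow> int) \<Rightarrow> bool" where
  "valuation v \<longleftrightarrow> (\<forall>l. v l \<in> {0, 1}) \<and> (\<forall>c. v (Neg c) = 1 - v (Pos c))"

primrec val :: "('c literal \<Rightarrow> int) \<Rightarrow> 'c form \<Rightarrow> int" where
  "val v (Lit l) = v l"
| "val v Bot = 0"
| "val v Top = 1"
| "val v (And \<phi> \<psi>) = min (val v \<phi>) (val v \<psi>)"
| "val v (Or \<phi> \<psi>) = max (val v \<phi>) (val v \<psi>)"
| "val v (Imp \<phi> \<psi>) = max (1 - val v \<phi>) (val v \<psi>)"

definition classical_conseq :: "'c form set \<Rightarrow> 'c form \<Rightarrow> bool" where
  "classical_conseq \<Gamma> \<phi> \<longleftrightarrow>
     (\<forall>v. valuation v \<longrightarrow> (\<forall>\<psi>\<in>\<Gamma>. val v \<psi> = 1) \<longrightarrow> val v \<phi> = 1)"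

text \<open>The term \<open>Rule [(L1, l1), \<dots>, (Ln, ln)] l\<close> is the atomic rule with premises
  \<open>Li \<Rightarrow> li\<close> and conclusion \<open>l\<close>; \<open>Rule [] l\<close> is the axiom \<open>\<Rightarrow> l\<close>.\<close>

datatype 'c rule = Rule "('c literal fset \<times> 'c literal) list" "'c literal"

type_synonym 'c base = "'c rule set"

text \<open>Derivability relates finite sets of literals to literals or absurdity.\<close>

datatype 'c concl = CLit "'c literal" | CBot

inductive derives :: "'c base \<Rightarrow> 'c literal fset \<Rightarrow> 'c concl \<Rightarrow> bool" for B :: "'c base" where
  REF: "l |\<in>| L \<Longrightarrow> derives B L (CLit l)"
| APP1: "Rule [] l \<in> B \<Longrightarrow> derives B L (CLit l)"
| APP2: "Rule ps l \<in> B \<Longrightarrow> \<forall>(K, k) \<in> set ps. derives B (L |\<union>| K) (CLit k)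
    \<Longrightarrow> derives B L (CLit l)"
| ABS: "derives B L (CLit m) \<Longrightarrow> derives B L (CLit (lit_dual m)) \<Longrightarrow> derives B L CBot"
| DM: "derives B (finsert m L) CBot \<Longrightarrow> derives B L (CLit (lit_dual m))"

text \<open>To keep the recursion structural, the implication and disjunction clauses are stated with
  the support judgements from one hypothesis, and support of a literal, written out.
  The lemmas \<open>supports_Imp\<close> and \<open>supports_Or\<close> below give them in terms of
  \<open>supports_from\<close>.\<close>

primrec supports :: "'c form \<Rightarrow> 'c base \<Rightarrow> bool" where
  "supports (Lit l) = (\<lambda>B. derives B {||} (CLit l))"
| "supports Bot = (\<lambda>B. \<forall>l. derives B {||} (CLit l))"
| "supports Top = (\<lambda>B. True)"
| "supports (And \<phi> \<psi>) = (\<lambda>B. supports \<phi> B \<and> supports \<psi> B)"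
| "supports (Or \<phi> \<psi>) = (\<lambda>B. \<forall>C l. B \<subseteq> C \<longrightarrow>
     (\<forall>D. C \<subseteq> D \<longrightarrow> supports \<phi> D \<longrightarrow> derives D {||} (CLit l)) \<longrightarrow>
     (\<forall>D. C \<subseteq> D \<longrightarrow> supports \<psi> D \<longrightarrow> derives D {||} (CLit l)) \<longrightarrow>
     derives C {||} (CLit l))"
| "supports (Imp \<phi> \<psi>) = (\<lambda>B. \<forall>C. B \<subseteq> C \<longrightarrow> supports \<phi> C \<longrightarrow> supports \<psi> C)"

definition supports_from :: "'c form set \<Rightarrow> 'c base \<Rightarrow> 'c form \<Rightarrow> bool" where
  "supports_from \<Delta> B \<phi> \<longleftrightarrow>
     (if \<Delta> = {} then supports \<phi> B
      else \<forall>C. B \<subseteq> C \<longrightarrow> (\<forall>\<delta>\<in>\<Delta>. supports \<delta> C) \<longrightarrow> supports \<phi> C)"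

lemma supports_Imp: "supports (Imp \<phi> \<psi>) B \<longleftrightarrow> supports_from {\<phi>} B \<psi>"
  by (simp add: supports_from_def)

lemma supports_Or:
  "supports (Or \<phi> \<psi>) B \<longleftrightarrow>
     (\<forall>C l. B \<subseteq> C \<longrightarrow> supports_from {\<phi>} C (Lit l) \<longrightarrow> supports_from {\<psi>} C (Lit l)
        \<longrightarrow> supports (Lit l) C)"
  by (simp add: supports_from_def)

definition valid :: "'c form set \<Rightarrow> 'c form \<Rightarrow> bool" where
  "valid \<Gamma> \<phi> \<longleftrightarrow> (\<forall>B. supports_from \<Gamma> B \<phi>)"

end

(* A valuation v is turned into the base whose axioms are the literals true under v. An extension of
   this base derives either exactly the true literals or all literals, and accordingly it supports
   either exactly the formulas true under v or all formulas. The base itself is of the first kind,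
   because its derivations are sound for v. *)

theory Submission
  imports Defs
begin

lemma derives_weaken:
  assumes "derives B L c" and "L |\<subseteq>| M"
  shows "derives B M c"
  using assms
proof (induction arbitrary: M rule: derives.induct)
  case (REF l L)
  then show ?case
    by (blast intro: derives.REF)
next
  case (APP1 l L)
  then show ?case
    by (blast intro: derives.APP1)
next
  case (APP2 ps l L)
  have "derives B (M |\<union>| K) (CLit k)" if "(K, k) \<in> set ps" for K k
    using bspec [OF APP2.IH that] funion_mono [OF APP2.prems order_refl, of K] by simp
  then have "\<forall>(K, k) \<in> set ps. derives B (M |\<union>| K) (CLit k)"
    by blast
  with APP2.hyps(1) show ?case
    by (rule derives.APP2)
next
  case (ABS L m)
  then show ?case
    by (blast intro: derives.ABS)
next
  case (DM m L)
  show ?case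
    by (rule derives.DM, rule DM.IH, rule finsert_mono, rule DM.prems)
qed

lemma derives_mono_base:
  assumes "derives B L c" and "B \<subseteq> C"
  shows "derives C L c"
  using assms(1)
proof (induction rule: derives.induct)
  case (APP2 ps l L)
  then have "\<forall>(K, k) \<in> set ps. derives C (L |\<union>| K) (CLit k)"
    by fast
  moreover have "Rule ps l \<in> C"
    using APP2.hyps assms(2) by blast
  ultimately show ?case
    by (blast intro: derives.APP2)
qed (use assms(2) in \<open>blast intro: derives.intros\<close>)+

lemma lit_dual_lit_dual [simp]: "lit_dual (lit_dual l) = l"
  by (cases l) simp_all

text \<open>Absurdity survives adding the dual of \<open>l\<close> as a hypothesis. DM then
  discharges that hypothesis and yields its dual, which is \<open>l\<close> itself.\<close>

lemma derives_explosion: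
  assumes "derives B L CBot"
  shows "derives B L (CLit l)"
proof -
  have "derives B (finsert (lit_dual l) L) CBot"
    using assms by (rule derives_weaken) blast
  from derives.DM [OF this] show ?thesis
    by simp
qed

lemma valuation_lit_dual: "valuation v \<Longrightarrow> v (lit_dual l) = 1 - v l"
  by (cases l) (simp_all add: valuation_def)

lemma valuation_cases: "valuation v \<Longrightarrow> v l = 0 \<or> v l = 1"
  by (auto simp: valuation_def)

lemma val_cases: "valuation v \<Longrightarrow> val v \<phi> = 0 \<or> val v \<phi> = 1"
  by (induction \<phi>) (auto simp: valuation_cases)

lemma valuation_false_literal:
  assumes "valuation v"
  obtains l where "v l \<noteq> 1"
proof -
  \<comment> \<open>Types are inhabited, so some content exists; its two literals have values
    summing to 1, hence one of them is false.\<close>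
  fix c
  have "v (Neg c) = 1 - v (Pos c)"
    using assms by (simp add: valuation_def)
  then show thesis
    using that [of "Pos c"] that [of "Neg c"] by linarith
qed

definition true_base :: "('c literal \<Rightarrow> int) \<Rightarrow> 'c base" where
  "true_base v = {Rule [] l | l. v l = 1}"

lemma derives_true_base_sound:
  assumes "derives (true_base v) L c" and "valuation v" and "\<And>l. l |\<in>| L \<Longrightarrow> v l = 1"
  shows "case c of CLit l \<Rightarrow> v l = 1 | CBot \<Rightarrow> False"
  using assms(1,3)
proof (induction rule: derives.induct)
  case (ABS L m)
  then show ?case
    by (simp add: valuation_lit_dual [OF assms(2)])
next
  case (DM m L)
  then show ?case
    \<comment> \<open>If \<open>m\<close> were true, all hypotheses in \<open>finsert m L\<close>
      would be true and the induction hypothesis would give a contradiction. So \<open>m\<close> is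
      false and its dual true.\<close>
    using valuation_cases [OF assms(2), of m] by (auto simp: valuation_lit_dual [OF assms(2)])
\<comment> \<open>The base contains axioms only, so a rule applied by APP2 has no premises and a
  true conclusion.\<close>
qed (auto simp: true_base_def)

text \<open>This is the support clause of \<open>Bot\<close>. It amounts to deriving
  \<open>CBot\<close> from no hypotheses, by ABS in one direction and
  \<open>derives_explosion\<close> in the other.\<close>

definition explosive :: "'c base \<Rightarrow> bool" where
  "explosive C \<longleftrightarrow> (\<forall>l. derives C {||} (CLit l))"

lemma explosive_mono: "explosive B \<Longrightarrow> B \<subseteq> C \<Longrightarrow> explosive C"
  by (auto simp: explosive_def intro: derives_mono_base)

lemma not_explosive_true_base:
  assumes "valuation v"
  shows "\<not> explosive (true_base v)"
proof -
  obtain l where "v l \<noteq> 1"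
    using valuation_false_literal [OF assms] .
  then show ?thesis
    using derives_true_base_sound [OF _ assms, of "{||}" "CLit l"] by (auto simp: explosive_def)
qed

text \<open>The dual of a false literal is an axiom of \<open>C\<close>, so deriving a false literal
  gives absurdity by ABS and then every literal.\<close>

lemma derives_literal_iff:
  assumes v: "valuation v" and C: "true_base v \<subseteq> C"
  shows "derives C {||} (CLit l) \<longleftrightarrow> v l = 1 \<or> explosive C"
proof
  have axiom: "derives C {||} (CLit k)" if "v k = 1" for k
    using that C by (auto simp: true_base_def intro: derives.APP1)
  show "derives C {||} (CLit l)" if "v l = 1 \<or> explosive C"
    using that axiom by (auto simp: explosive_def)
  show "v l = 1 \<or> explosive C" if l: "derives C {||} (CLit l)"
  proof (cases "v l = 1")
    case False
    then have "v (lit_dual l) = 1"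
      using valuation_cases [OF v, of l] by (simp add: valuation_lit_dual [OF v])
    then have "derives C {||} CBot"
      using l axiom by (blast intro: derives.ABS)
    then show ?thesis
      by (simp add: explosive_def derives_explosion)
  qed simp
qed

text \<open>The induction ranges over all extensions of \<open>true_base v\<close>, since the
  clauses for \<open>Or\<close> and \<open>Imp\<close> quantify over them; the second disjunct
  accounts for the explosive ones.\<close>

lemma supports_iff:
  assumes v: "valuation v" and "true_base v \<subseteq> C"
  shows "supports \<phi> C \<longleftrightarrow> val v \<phi> = 1 \<or> explosive C"
  using assms(2)
proof (induction \<phi> arbitrary: C)
  case (Lit l)
  then show ?case
    by (simp add: derives_literal_iff [OF v])
next
  case Bot
  then show ?case
    by (simp add: explosive_def)
next
  case Top
  then show ?case
    by simp
next
  case (And \<phi> \<psi>)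
  then show ?case
    using val_cases [OF v, of \<phi>] val_cases [OF v, of \<psi>] by auto
next
  case (Or \<phi> \<psi>)
  obtain k where k: "v k \<noteq> 1"
    using valuation_false_literal [OF v] .
  have ext: "true_base v \<subseteq> D" if "C \<subseteq> D" for D
    using Or.prems that by blast
  have lit: "derives D {||} (CLit l) \<longleftrightarrow> v l = 1 \<or> explosive D" if "C \<subseteq> D" for D l
    using derives_literal_iff [OF v ext [OF that]] .
  have IH: "supports \<phi> D \<longleftrightarrow> val v \<phi> = 1 \<or> explosive D"
    "supports \<psi> D \<longleftrightarrow> val v \<psi> = 1 \<or> explosive D" if "C \<subseteq> D" for D
    using Or.IH ext [OF that] by blast+
  have val_Or: "val v (Or \<phi> \<psi>) = 1 \<longleftrightarrow> val v \<phi> = 1 \<or> val v \<psi> = 1"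
    using val_cases [OF v, of \<phi>] val_cases [OF v, of \<psi>] by auto
  show ?case
  proof
    assume sup: "supports (Or \<phi> \<psi>) C"
    show "val v (Or \<phi> \<psi>) = 1 \<or> explosive C"
    proof (rule ccontr)
      assume not: "\<not> (val v (Or \<phi> \<psi>) = 1 \<or> explosive C)"
      \<comment> \<open>Both disjuncts are supported only in explosive extensions, which also derive the false
          literal \<open>k\<close>; so the disjunction clause forces \<open>k\<close> in \<open>C\<close>.\<close>
      then have "\<forall>D. C \<subseteq> D \<longrightarrow> supports \<phi> D \<longrightarrow> derives D {||} (CLit k)"
        "\<forall>D. C \<subseteq> D \<longrightarrow> supports \<psi> D \<longrightarrow> derives D {||} (CLit k)"
        using val_Or IH lit by blast+
      then have "derives C {||} (CLit k)"
        using sup unfolding supports.simps by blast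
      then show False
        using not k lit by blast
    qed
  next
    assume "val v (Or \<phi> \<psi>) = 1 \<or> explosive C"
    \<comment> \<open>One and the same disjunct is supported in every extension, so the matching
      premise of the disjunction clause, taken at the extension itself, delivers the
      literal.\<close>
    then have "(\<forall>D. C \<subseteq> D \<longrightarrow> supports \<phi> D) \<or> (\<forall>D. C \<subseteq> D \<longrightarrow> supports \<psi> D)"
      using val_Or IH explosive_mono by blast
    then show "supports (Or \<phi> \<psi>) C"
      unfolding supports.simps by blast
  qed
next
  case (Imp \<phi> \<psi>)
  have IH: "supports \<phi> D \<longleftrightarrow> val v \<phi> = 1 \<or> explosive D"
    "supports \<psi> D \<longleftrightarrow> val v \<psi> = 1 \<or> explosive D" if "C \<subseteq> D" for D
    using Imp.IH [OF subset_trans [OF Imp.prems that]] by blast+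
  have val_Imp: "val v (Imp \<phi> \<psi>) = 1 \<longleftrightarrow> (val v \<phi> = 1 \<longrightarrow> val v \<psi> = 1)"
    using val_cases [OF v, of \<phi>] val_cases [OF v, of \<psi>] by auto
  have "supports (Imp \<phi> \<psi>) C \<longleftrightarrow>
      (\<forall>D. C \<subseteq> D \<longrightarrow> val v \<phi> = 1 \<or> explosive D \<longrightarrow> val v \<psi> = 1 \<or> explosive D)"
    by (simp add: IH cong: imp_cong)
  \<comment> \<open>From left to right take \<open>D\<close> to be \<open>C\<close>; from right to
    left explosiveness passes to every \<open>D\<close>.\<close>
  also have "\<dots> \<longleftrightarrow> (val v \<phi> = 1 \<longrightarrow> val v \<psi> = 1) \<or> explosive C"
    using explosive_mono by blast
  finally show ?case
    by (simp only: val_Imp)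
qed

theorem mainTheorem7:
  fixes \<Gamma> :: "'c form set" and \<gamma> :: "'c form"
  assumes "infinite (UNIV :: 'c set)" and "countable (UNIV :: 'c set)"
    and "finite \<Gamma>"
    and "valid \<Gamma> \<gamma>"
  shows "classical_conseq \<Gamma> \<gamma>"
  unfolding classical_conseq_def
proof (intro allI impI)
  fix v
  assume v: "valuation v" and \<Gamma>: "\<forall>\<psi>\<in>\<Gamma>. val v \<psi> = 1"
  \<comment> \<open>At \<open>true_base v\<close> itself the explosive alternative is excluded, so
    support coincides with truth under \<open>v\<close>.\<close>
  have iff: "supports \<phi> (true_base v) \<longleftrightarrow> val v \<phi> = 1" for \<phi>
    using supports_iff [OF v order_refl] not_explosive_true_base [OF v] by blast
  have "supports_from \<Gamma> (true_base v) \<gamma>"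
    using assms(4) by (simp add: valid_def)
  then have "supports \<gamma> (true_base v)"
    using \<Gamma> by (auto simp: supports_from_def iff split: if_splits)
  then show "val v \<gamma> = 1"
    by (simp add: iff)
qed

end
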